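(* Let $0<p<\infty$. Let $\phi$ be an elliptic automorphism of the open unit disk $\mathbb{D}$ with $0$ as its unique fixed point in $\mathbb{D}$, and let $S_{\mu_1}$ and $S_{\mu_2}$ be two singular inner functions. Then $C_\phi(S_{\mu_1}H^p)\subseteq S_{\mu_2}H^p$ if and only if $\mu_2(E)\le\mu_1(\phi(E))$ for every Borel subset $E$ of the unit circle $\mathbb{T}$.
   Context: An elliptic automorphism is a holomorphic automorphism of $\mathbb{D}$, other than the identity, having a fixed point in $\mathbb{D}$; disk automorphisms extend to homeomorphisms of $\mathbb{T}$. For a finite positive Borel measure $\mu$ on $\mathbb{T}$ that is singular with respect to Lebesgue measure, $S_\mu(z)=\alpha\exp\left(-\int_{\mathbb{T}}\frac{t+z}{t-z}\,d\mu(t)\right)$, $z\in\mathbb{D}$, for some unimodular constant $\alpha$; such functions are the singular inner functions. $H^p$ is the Hardy space on $\mathbb{D}$, $\theta H^p=\{\theta f:f\in H^p\}$, and $C_\phi(f)=f\circ\phi$. *)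

theory Defs
  imports "HOL-Analysis.Analysis" "HOL-Library.FuncSet"
begin

abbreviation unit_disk :: "complex set" where
  "unit_disk \<equiv> ball 0 1"

abbreviation unit_circle :: "complex set" where
  "unit_circle \<equiv> sphere 0 1"

definition disk_automorphism :: "(complex \<Rightarrow> complex) \<Rightarrow> bool" where
  "disk_automorphism \<phi> \<longleftrightarrow>
     bij_betw \<phi> unit_disk unit_disk \<and>
     \<phi> holomorphic_on unit_disk \<and>
     inv_into unit_disk \<phi> holomorphic_on unit_disk"

definition elliptic_automorphism :: "(complex \<Rightarrow> complex) \<Rightarrow> bool" where
  "elliptic_automorphism \<phi> \<longleftrightarrow>
     disk_automorphism \<phi> \<and>
     (\<exists>z\<in>unit_disk. \<phi> z \<noteq> z) \<and>
     (\<exists>z\<in>unit_disk. \<phi> z = z)"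

text \<open>The values of \<open>\<phi>\<close> outside the open disk play no role; its continuous extension to the circle
  is given by limits from inside the disk.\<close>

definition circle_extension :: "(complex \<Rightarrow> complex) \<Rightarrow> complex \<Rightarrow> complex" where
  "circle_extension \<phi> t = Lim (at t within unit_disk) \<phi>"

definition circle_borel :: "complex measure" where
  "circle_borel = restrict_space borel unit_circle"

text \<open>Lebesgue measure on the circle, normalised to total mass 1.\<close>

definition circle_lebesgue :: "complex measure" where
  "circle_lebesgue = distr (uniform_measure lborel {0..<2 * pi}) circle_borel cis"

definition mutually_singular :: "'a measure \<Rightarrow> 'a measure \<Rightarrow> bool" where
  "mutually_singular M N \<longleftrightarrow>
     (\<exists>A\<in>sets M \<inter> sets N. emeasure M A = 0 \<and> emeasure N (space N - A) = 0)"

definition singular_inner_function :: "complex measure \<Rightarrow> (complex \<Rightarrow> complex) \<Rightarrow> bool" where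
  "singular_inner_function \<mu> S \<longleftrightarrow>
     finite_measure \<mu> \<and> sets \<mu> = sets circle_borel \<and>
     mutually_singular \<mu> circle_lebesgue \<and>
     (\<exists>\<alpha>. norm \<alpha> = 1 \<and>
        (\<forall>z\<in>unit_disk. S z = \<alpha> * exp (- (LINT t|\<mu>. (t + z) / (t - z)))))"

text \<open>Functions on the open disk are represented by \<^const>\<open>extensional\<close> functions, so that equality
  of elements of the spaces below is equality on the disk.\<close>

definition hardy_space :: "real \<Rightarrow> (complex \<Rightarrow> complex) set" where
  "hardy_space p =
     {f \<in> extensional unit_disk. f holomorphic_on unit_disk \<and>
        (SUP r\<in>{0..<1}. \<integral>\<^sup>+ t. ennreal (norm (f (complex_of_real r * t)) powr p) \<partial>circle_lebesgue) < \<infinity>}"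

definition hardy_multiples :: "(complex \<Rightarrow> complex) \<Rightarrow> real \<Rightarrow> (complex \<Rightarrow> complex) set" where
  "hardy_multiples \<theta> p = (\<lambda>f. \<lambda>z\<in>unit_disk. \<theta> z * f z) ` hardy_space p"

definition composition_operator ::
    "(complex \<Rightarrow> complex) \<Rightarrow> (complex \<Rightarrow> complex) \<Rightarrow> complex \<Rightarrow> complex" where
  "composition_operator \<phi> f = compose unit_disk f \<phi>"

end

theory Submission
  imports Defs "HOL-Complex_Analysis.Complex_Analysis"
begin

text \<open>By the Schwarz lemma, applied to \<open>\<phi>\<close> and to its inverse, \<open>\<phi>\<close> is a rotation
  \<open>z \<mapsto> \<omega> z\<close>. The change of variable \<open>t = \<omega> s\<close> in the exponent shows that \<open>S\<^sub>1 \<circ> \<phi>\<close> has the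
  modulus of the singular inner function of the rotated measure \<open>\<nu>\<close>, \<open>\<nu> E = \<mu>\<^sub>1 (\<omega> E)\<close>.
  Rotations preserve the Hardy space, so the inclusion says that multiplication by the zero-free
  quotient \<open>q = (S\<^sub>1 \<circ> \<phi>) / S\<^sub>2\<close> maps the Hardy space to itself, and the claim is that this is
  equivalent to \<open>\<mu>\<^sub>2 \<le> \<nu>\<close>. Everything is read off from the modulus: the real part of the Herglotz
  kernel \<open>(t + z) / (t - z)\<close> is the Poisson kernel, hence \<open>log |q|\<close> is the Poisson integral
  \<open>w = P[\<mu>\<^sub>2] - P[\<nu>]\<close>.

  If \<open>\<mu>\<^sub>2 \<le> \<nu>\<close>, then \<open>w \<le> 0\<close> because the Poisson kernel is positive (\<open>poisson_integral_mono\<close>).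
  So \<open>|q| \<le> 1\<close>, and multiplication by \<open>q\<close> preserves the Hardy space.

  For the converse, the inclusion applied to the constant function \<open>1\<close> shows that \<open>q\<close> itself lies in
  the Hardy space. The means of \<open>|q|^p = exp (p w)\<close> over circles of radius \<open>r < 1\<close> are therefore
  bounded by some \<open>C\<close>. Exponential integrability forces the positive part of \<open>w\<close> to be uniformly
  integrable, so that the positive part of \<open>\<mu>\<^sub>2 - \<nu>\<close> can have no singular component.
  Quantitatively, \<open>x \<le> k + exp (x - k)\<close> with \<open>x = p w\<close> gives, for every continuous
  \<open>0 \<le> f \<le> 1\<close> on the circle and every real \<open>k\<close>,
  \<open>\<integral> f w(r t) dm(t) \<le> (k \<integral> f dm + exp (- k) C) / p\<close>, where \<open>m\<close> is Lebesgue measure. As \<open>r\<close> tends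
  to 1, the left-hand side tends to \<open>\<integral> f d\<mu>\<^sub>2 - \<integral> f d\<nu>\<close>, because Poisson integrals converge weakly to
  their boundary measures (\<open>poisson_integral_weak_limit\<close>). Letting \<open>f\<close> decrease to the indicator of a
  compact set \<open>K\<close> with \<open>m K = 0\<close>, and then \<open>k\<close> tend to infinity, yields \<open>\<mu>\<^sub>2 K \<le> \<nu> K\<close>. Inner
  regularity extends this to all Borel null sets, and singularity of \<open>\<mu>\<^sub>2\<close> to all Borel sets
  (\<open>singular_measure_domination\<close>).\<close>

section \<open>The Herglotz kernel\<close>

definition herglotz_kernel :: "complex \<Rightarrow> complex \<Rightarrow> complex" where
  "herglotz_kernel z t = (t + z) / (t - z)"

definition poisson_integral :: "complex measure \<Rightarrow> complex \<Rightarrow> real" where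
  "poisson_integral \<mu> z = (LINT t|\<mu>. Re (herglotz_kernel z t))"

lemma measurable_herglotz_kernel [measurable]:
  assumes [measurable]: "f \<in> borel_measurable M" "g \<in> borel_measurable M"
  shows "(\<lambda>x. herglotz_kernel (f x) (g x)) \<in> borel_measurable M"
  unfolding herglotz_kernel_def by measurable

lemma norm_diff_circle_ge:
  fixes t z :: complex
  assumes "norm t = 1"
  shows "1 - norm z \<le> norm (t - z)"
  using norm_triangle_ineq2[of t z] assms by simp

lemma norm_herglotz_kernel_le:
  assumes "norm t = 1" "norm z < 1"
  shows "norm (herglotz_kernel z t) \<le> 2 / (1 - norm z)"
proof -
  have "norm (t + z) \<le> 2"
    using norm_triangle_ineq[of t z] assms by simp
  thus ?thesis
    using norm_diff_circle_ge[OF assms(1), of z] assms(2)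
    unfolding herglotz_kernel_def norm_divide by (intro frac_le) auto
qed

text \<open>The real part of the Herglotz kernel is the Poisson kernel.\<close>

lemma Re_herglotz_kernel:
  assumes "norm t = 1"
  shows "Re (herglotz_kernel z t) = (1 - (norm z)\<^sup>2) / (norm (t - z))\<^sup>2"
proof -
  have "Re ((t + z) * cnj (t - z)) = (norm t)\<^sup>2 - (norm z)\<^sup>2"
    unfolding cmod_power2 by (simp add: power2_eq_square algebra_simps)
  thus ?thesis
    unfolding herglotz_kernel_def complex_div_cnj[of "t + z"] using assms
    by (simp flip: of_real_power)
qed

lemma Re_herglotz_kernel_nonneg:
  assumes "norm t = 1" "norm z < 1"
  shows "0 \<le> Re (herglotz_kernel z t)"
  using assms by (simp add: Re_herglotz_kernel power_le_one)

text \<open>The distances \<open>|s - r t|\<close> and \<open>|t - r s|\<close> agree for points of the circle. Because of this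
  symmetry, testing the Poisson integral of a measure against a function amounts to integrating the
  Poisson integral of the function against the measure (\<open>integral_mult_poisson_integral\<close> below).\<close>

lemma Re_herglotz_kernel_swap:
  assumes s: "norm s = 1" and t: "norm t = 1"
  shows "Re (herglotz_kernel (complex_of_real r * t) s) = Re (herglotz_kernel (complex_of_real r * s) t)"
proof -
  have "(norm (s - complex_of_real r * t))\<^sup>2 = (norm (t - complex_of_real r * s))\<^sup>2"
  proof -
    have "(Re s)\<^sup>2 + (Im s)\<^sup>2 = 1" "(Re t)\<^sup>2 + (Im t)\<^sup>2 = 1"
      using s t by (simp_all flip: cmod_power2)
    thus ?thesis
      unfolding cmod_power2 by (simp add: power2_eq_square) algebra
  qed
  thus ?thesis
    using s t by (simp add: Re_herglotz_kernel norm_mult)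
qed


section \<open>Measures on the circle and their Herglotz integrals\<close>

locale circle_measure = finite_measure \<mu> for \<mu> :: "complex measure" +
  assumes sets_circle [measurable_cong]: "sets \<mu> = sets circle_borel"
begin

lemma space_circle: "space \<mu> = unit_circle"
  using sets_eq_imp_space_eq[OF sets_circle] by (simp add: circle_borel_def)

lemma measurable_ident_circle [measurable]: "(\<lambda>t. t) \<in> borel_measurable \<mu>"
  unfolding measurable_cong_sets[OF sets_circle refl] circle_borel_def
  by (intro measurable_restrict_space1) auto

lemma integrable_herglotz_kernel:
  assumes "norm z < 1"
  shows "integrable \<mu> (herglotz_kernel z)"
proof (rule integrable_const_bound)
  show "AE t in \<mu>. norm (herglotz_kernel z t) \<le> 2 / (1 - norm z)"
    using assms by (intro AE_I2 norm_herglotz_kernel_le) (auto simp: space_circle)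
qed measurable

lemma poisson_integral_eq_Re:
  assumes "norm z < 1"
  shows "poisson_integral \<mu> z = Re (LINT t|\<mu>. herglotz_kernel z t)"
  unfolding poisson_integral_def using integrable_herglotz_kernel[OF assms] by simp

text \<open>Differentiation under the integral sign. The divided difference of the kernel and its derivative
  \<open>2 t / (t - z)\<^sup>2\<close> differ by \<open>2 t (w - z) / ((t - w) (t - z)\<^sup>2)\<close>, which is \<open>O(|w - z|)\<close> uniformly
  in \<open>t\<close> as long as \<open>w\<close> and \<open>z\<close> stay away from the circle.\<close>

lemma holomorphic_herglotz_integral:
  "(\<lambda>z. LINT t|\<mu>. herglotz_kernel z t) holomorphic_on unit_disk"
proof -
  have "((\<lambda>z. LINT t|\<mu>. herglotz_kernel z t) has_field_derivative
          (LINT t|\<mu>. 2 * t / (t - z)\<^sup>2)) (at z)" if z: "norm z < 1" for z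
  proof -
    \<comment> \<open>Points closer than \<open>\<delta>\<close> to \<open>z\<close> have distance at least \<open>\<delta>\<close> from the circle.\<close>
    define \<delta> where "\<delta> = (1 - norm z) / 2"
    have \<delta>: "0 < \<delta>" using z by (simp add: \<delta>_def)
    have far: "\<delta> \<le> norm (t - w)" if "norm t = 1" "dist w z < \<delta>" for t w
    proof -
      have "norm w \<le> norm z + norm (w - z)"
        using norm_triangle_ineq[of z "w - z"] by simp
      with that show ?thesis
        using norm_diff_circle_ge[OF that(1), of w] by (simp add: \<delta>_def dist_norm field_simps)
    qed
    have int_deriv: "integrable \<mu> (\<lambda>t. 2 * t / (t - z)\<^sup>2)"
    proof (rule integrable_const_bound)
      show "AE t in \<mu>. norm (2 * t / (t - z)\<^sup>2) \<le> 2 / \<delta>\<^sup>2"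
        using far[of _ z] \<delta> unfolding norm_divide norm_power norm_mult
        by (intro AE_I2 frac_le power_mono) (auto simp: space_circle)
    qed measurable
    have bound: "norm (((LINT t|\<mu>. herglotz_kernel w t) - (LINT t|\<mu>. herglotz_kernel z t)) / (w - z)
              - (LINT t|\<mu>. 2 * t / (t - z)\<^sup>2)) \<le> 2 * dist w z / \<delta> ^ 3 * measure \<mu> (space \<mu>)"
      if w: "w \<noteq> z" "dist w z < \<delta>" for w
    proof -
      have w1: "norm w < 1"
        using norm_triangle_ineq[of z "w - z"] w(2) z by (simp add: \<delta>_def dist_norm field_simps)
      have "((LINT t|\<mu>. herglotz_kernel w t) - (LINT t|\<mu>. herglotz_kernel z t)) / (w - z)
              - (LINT t|\<mu>. 2 * t / (t - z)\<^sup>2)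
          = (LINT t|\<mu>. (herglotz_kernel w t - herglotz_kernel z t) / (w - z) - 2 * t / (t - z)\<^sup>2)"
        using integrable_herglotz_kernel[OF w1] integrable_herglotz_kernel[OF z] int_deriv by simp
      also have "norm \<dots> \<le> (LINT t|\<mu>. 2 * dist w z / \<delta> ^ 3)"
      proof (rule order_trans[OF integral_norm_bound], rule integral_mono)
        fix t assume "t \<in> space \<mu>"
        hence t: "norm t = 1" by (simp add: space_circle)
        have ne: "t - w \<noteq> 0" "t - z \<noteq> 0" "w - z \<noteq> 0"
          using far[OF t, of w] far[OF t, of z] w \<delta> by auto
        have "(herglotz_kernel w t - herglotz_kernel z t) / (w - z) - 2 * t / (t - z)\<^sup>2
            = 2 * t * (w - z) / ((t - w) * (t - z)\<^sup>2)"
          using ne unfolding herglotz_kernel_def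
          by (simp add: divide_simps power2_eq_square) (simp add: algebra_simps)
        moreover have "norm (2 * t * (w - z) / ((t - w) * (t - z)\<^sup>2)) \<le> 2 * dist w z / \<delta> ^ 3"
          unfolding norm_divide norm_mult norm_power power3_eq_cube power2_eq_square
          using far[OF t, of w] far[OF t, of z] w \<delta> t
          by (intro frac_le) (auto simp: dist_norm mult.assoc intro!: mult_mono)
        ultimately show "norm ((herglotz_kernel w t - herglotz_kernel z t) / (w - z)
            - 2 * t / (t - z)\<^sup>2) \<le> 2 * dist w z / \<delta> ^ 3" by simp
      qed (use integrable_herglotz_kernel[OF w1] integrable_herglotz_kernel[OF z] int_deriv in auto)
      finally show ?thesis by (simp add: mult_ac)
    qed
    show ?thesis
      unfolding has_field_derivative_iff
    proof (rule LIM_zero_cancel, rule Lim_null_comparison)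
      show "\<forall>\<^sub>F w in at z. norm (((LINT t|\<mu>. herglotz_kernel w t) - (LINT t|\<mu>. herglotz_kernel z t)) / (w - z)
              - (LINT t|\<mu>. 2 * t / (t - z)\<^sup>2)) \<le> 2 * dist w z / \<delta> ^ 3 * measure \<mu> (space \<mu>)"
        unfolding eventually_at using bound \<delta> by blast
      show "((\<lambda>w. 2 * dist w z / \<delta> ^ 3 * measure \<mu> (space \<mu>)) \<longlongrightarrow> 0) (at z)"
        using \<delta> by (auto intro!: tendsto_eq_intros)
    qed
  qed
  thus ?thesis
    by (subst holomorphic_on_open) fastforce+
qed

end


section \<open>Normalised Lebesgue measure on the circle\<close>

lemma measurable_cis [measurable]: "cis \<in> borel \<rightarrow>\<^sub>M circle_borel"
  unfolding circle_borel_def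
  by (intro measurable_restrict_space2 borel_measurable_continuous_onI continuous_intros) auto

lemma measurable_circle_lebesgue_cis:
  "cis \<in> uniform_measure lborel {0..<2 * pi} \<rightarrow>\<^sub>M circle_borel"
  using measurable_cis by (simp cong: measurable_cong_sets)

lemma emeasure_space_circle_lebesgue: "emeasure circle_lebesgue (space circle_lebesgue) = 1"
proof -
  have "cis -` space circle_borel = UNIV"
    using measurable_space[OF measurable_cis] by auto
  hence "emeasure circle_lebesgue (space circle_lebesgue) = emeasure (uniform_measure lborel {0..<2 * pi}) UNIV"
    unfolding circle_lebesgue_def
    by (subst emeasure_distr[OF measurable_circle_lebesgue_cis]) auto
  thus ?thesis
    by (simp add: ennreal_divide_self)
qed

interpretation circle_lebesgue: circle_measure circle_lebesgue
proof (intro circle_measure.intro circle_measure_axioms.intro finite_measureI)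
  show "emeasure circle_lebesgue (space circle_lebesgue) \<noteq> \<infinity>"
    by (simp add: emeasure_space_circle_lebesgue)
  show "sets circle_lebesgue = sets circle_borel"
    by (simp add: circle_lebesgue_def)
qed

lemma measure_space_circle_lebesgue [simp]: "measure circle_lebesgue (space circle_lebesgue) = 1"
  by (simp add: measure_def emeasure_space_circle_lebesgue)

lemma nn_integral_circle_lebesgue:
  assumes [measurable]: "f \<in> borel_measurable circle_borel"
  shows "(\<integral>\<^sup>+ t. f t \<partial>circle_lebesgue)
       = (\<integral>\<^sup>+ x. f (cis x) * indicator {0..<2 * pi} x \<partial>lborel) / ennreal (2 * pi)"
proof -
  have "(\<integral>\<^sup>+ t. f t \<partial>circle_lebesgue) = (\<integral>\<^sup>+ x. f (cis x) \<partial>uniform_measure lborel {0..<2 * pi})"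
    unfolding circle_lebesgue_def by (subst nn_integral_distr[OF measurable_circle_lebesgue_cis]) simp_all
  thus ?thesis
    by (subst (asm) nn_integral_uniform_measure) auto
qed

lemma lebesgue_integral_circle_lebesgue:
  fixes f :: "complex \<Rightarrow> complex"
  assumes cont: "continuous_on unit_circle f"
  shows "(LINT t|circle_lebesgue. f t) = integral {0..2 * pi} (\<lambda>x. f (cis x)) / (2 * pi)"
proof -
  have f [measurable]: "f \<in> borel_measurable circle_borel"
    unfolding circle_borel_def by (intro borel_measurable_continuous_on_restrict cont)
  have cf: "continuous_on {0..2 * pi} (\<lambda>x. f (cis x))"
    by (rule continuous_on_compose2[OF cont]) (auto intro!: continuous_intros)
  have "(LINT t|circle_lebesgue. f t) = (LINT x|uniform_measure lborel {0..<2 * pi}. f (cis x))"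
    unfolding circle_lebesgue_def by (intro integral_distr measurable_circle_lebesgue_cis f)
  also have "\<dots> = (LINT x|density lborel (\<lambda>x. ennreal (indicator {0..<2 * pi} x / (2 * pi))). f (cis x))"
    unfolding uniform_measure_def
    by (intro arg_cong2[where f = lebesgue_integral] density_cong)
       (use divide_ennreal[of 1 "2 * pi"] in \<open>auto simp: indicator_def\<close>)
  also have "\<dots> = (LINT x|lborel. (indicator {0..<2 * pi} x / (2 * pi)) *\<^sub>R f (cis x))"
    by (intro integral_density) auto
  also have "\<dots> = (LINT x|lborel. (indicator {0..2 * pi} x *\<^sub>R f (cis x)) / (2 * pi))"
  proof (rule integral_cong_AE)
    show "AE x in lborel. (indicator {0..<2 * pi} x / (2 * pi)) *\<^sub>R f (cis x)
        = (indicator {0..2 * pi} x *\<^sub>R f (cis x)) / (2 * pi)"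
      using AE_lborel_singleton[of "2 * pi"]
      by eventually_elim (auto simp: indicator_def scaleR_conv_of_real)
  qed measurable
  also have "\<dots> = (LINT x:{0..2 * pi}|lborel. f (cis x)) / (2 * pi)"
    unfolding set_lebesgue_integral_def by simp
  also have "(LINT x:{0..2 * pi}|lborel. f (cis x)) = integral {0..2 * pi} (\<lambda>x. f (cis x))"
    by (intro set_borel_integral_eq_integral borel_integrable_atLeastAtMost' cf)
  finally show ?thesis .
qed

text \<open>This is Cauchy's formula at the centre: along a circle around the origin, \<open>du / u = \<i> dx\<close>.\<close>

lemma circle_lebesgue_mean_value:
  assumes holo: "h holomorphic_on unit_disk" and r: "0 \<le> r" "r < 1"
  shows "(LINT t|circle_lebesgue. h (complex_of_real r * t)) = h 0"
proof (cases "r = 0")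
  case True
  thus ?thesis by simp
next
  case False
  hence r0: "0 < r" using r by simp
  have sub: "cball 0 r \<subseteq> unit_disk" using r by auto
  have "((\<lambda>u. h u / (u - 0)) has_contour_integral (2 * of_real pi * \<i> * h 0)) (circlepath 0 r)"
    using r0 holo sub by (intro Cauchy_integral_circlepath_simple holomorphic_on_subset[OF holo]) auto
  hence "((\<lambda>x. h (0 + r * cis x) / (0 + r * cis x - 0) * r * \<i> * cis x)
            has_integral (2 * of_real pi * \<i> * h 0)) {0..2 * pi}"
    unfolding circlepath_def by (subst (asm) has_contour_integral_part_circlepath_iff) auto
  hence "((\<lambda>x. h (r * cis x) * \<i>) has_integral (2 * of_real pi * \<i> * h 0)) {0..2 * pi}"
    by (rule has_integral_eq[rotated]) (use r0 in auto)
  from has_integral_mult_right[OF this, of "- \<i>"]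
  have "((\<lambda>x. h (r * cis x)) has_integral (2 * of_real pi * h 0)) {0..2 * pi}"
    by (simp add: mult_ac)
  moreover have "continuous_on unit_circle (\<lambda>t. h (complex_of_real r * t))"
    using r by (intro continuous_on_compose2[OF holomorphic_on_imp_continuous_on[OF holo]] continuous_intros)
      (auto simp: norm_mult)
  ultimately show ?thesis
    by (simp add: lebesgue_integral_circle_lebesgue integral_unique)
qed

text \<open>By symmetry the kernel may be read as a function of \<open>r t\<close>, where it is the real part of
  a holomorphic function with value \<open>1\<close> at the origin.\<close>

lemma poisson_kernel_mean:
  assumes s: "norm s = 1" and r: "0 \<le> r" "r < 1"
  shows "(LINT t|circle_lebesgue. Re (herglotz_kernel (complex_of_real r * s) t)) = 1"
proof -
  have "(LINT t|circle_lebesgue. Re (herglotz_kernel (complex_of_real r * s) t))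
      = (LINT t|circle_lebesgue. Re (herglotz_kernel (complex_of_real r * t) s))"
    by (intro Bochner_Integration.integral_cong refl Re_herglotz_kernel_swap)
       (use s in \<open>auto simp: circle_lebesgue.space_circle\<close>)
  also have "\<dots> = Re (LINT t|circle_lebesgue. herglotz_kernel (complex_of_real r * t) s)"
  proof (rule integral_Re)
    show "complex_integrable circle_lebesgue (\<lambda>t. herglotz_kernel (complex_of_real r * t) s)"
    proof (rule circle_lebesgue.integrable_const_bound)
      show "AE t in circle_lebesgue. norm (herglotz_kernel (complex_of_real r * t) s) \<le> 2 / (1 - r)"
      proof (rule AE_I2)
        fix t assume "t \<in> space circle_lebesgue"
        thus "norm (herglotz_kernel (complex_of_real r * t) s) \<le> 2 / (1 - r)"
          using norm_herglotz_kernel_le[OF s, of "complex_of_real r * t"] r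
          by (simp add: circle_lebesgue.space_circle norm_mult)
      qed
    qed measurable
  qed
  also have "(LINT t|circle_lebesgue. herglotz_kernel (complex_of_real r * t) s) = herglotz_kernel 0 s"
  proof (rule circle_lebesgue_mean_value)
    show "(\<lambda>z. herglotz_kernel z s) holomorphic_on unit_disk"
      unfolding herglotz_kernel_def using s by (intro holomorphic_intros) auto
  qed (use r in auto)
  also have "Re (herglotz_kernel 0 s) = 1"
    using s by (auto simp: herglotz_kernel_def)
  finally show ?thesis .
qed

text \<open>The integral over a shifted period is the same: the piece of \<open>{a..<c + a}\<close> beyond \<open>c\<close> is moved
  back by one period to fill the gap \<open>{0..<a}\<close>.\<close>

lemma nn_integral_periodic_shift:
  fixes f :: "real \<Rightarrow> ennreal"
  assumes [measurable]: "f \<in> borel_measurable borel" and per: "\<And>x. f (x + c) = f x"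
    and a: "0 \<le> a" "a \<le> c"
  shows "(\<integral>\<^sup>+ x. f (a + x) * indicator {0..<c} x \<partial>lborel) = (\<integral>\<^sup>+ x. f x * indicator {0..<c} x \<partial>lborel)"
proof -
  have per': "f (c + x) = f x" for x
    using per[of x] by (simp add: add.commute)
  have split: "(\<integral>\<^sup>+ x. g x * indicator {u..<w} x \<partial>lborel)
        = (\<integral>\<^sup>+ x. g x * indicator {u..<v} x \<partial>lborel) + (\<integral>\<^sup>+ x. g x * indicator {v..<w} x \<partial>lborel)"
    if [measurable]: "g \<in> borel_measurable borel" and "u \<le> v" "v \<le> w"
    for g :: "real \<Rightarrow> ennreal" and u v w
    using that by (subst nn_integral_add[symmetric]) (auto intro!: nn_integral_cong simp: indicator_def)
  have "(\<integral>\<^sup>+ x. f (a + x) * indicator {0..<c} x \<partial>lborel) = (\<integral>\<^sup>+ x. f x * indicator {a..<c + a} x \<partial>lborel)"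
    by (subst nn_integral_real_affine[where t = a and c = 1 and f = "\<lambda>x. f x * indicator {a..<c + a} x"])
       (auto intro!: nn_integral_cong simp: indicator_def)
  also have "\<dots> = (\<integral>\<^sup>+ x. f x * indicator {a..<c} x \<partial>lborel) + (\<integral>\<^sup>+ x. f x * indicator {c..<c + a} x \<partial>lborel)"
    using a by (intro split) auto
  also have "(\<integral>\<^sup>+ x. f x * indicator {c..<c + a} x \<partial>lborel) = (\<integral>\<^sup>+ x. f x * indicator {0..<a} x \<partial>lborel)"
    by (subst nn_integral_real_affine[where t = c and c = 1 and f = "\<lambda>x. f x * indicator {c..<c + a} x"])
       (auto intro!: nn_integral_cong simp: indicator_def per')
  also have "(\<integral>\<^sup>+ x. f x * indicator {a..<c} x \<partial>lborel) + (\<integral>\<^sup>+ x. f x * indicator {0..<a} x \<partial>lborel)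
           = (\<integral>\<^sup>+ x. f x * indicator {0..<c} x \<partial>lborel)"
    using split[of f 0 a c] a by (simp add: add.commute)
  finally show ?thesis .
qed

lemma measurable_rotate_circle [measurable]:
  assumes "norm \<omega> = 1"
  shows "(*) \<omega> \<in> circle_borel \<rightarrow>\<^sub>M circle_borel"
  unfolding circle_borel_def using assms
  by (intro measurable_restrict_space3) (auto simp: norm_mult)

lemma nn_integral_circle_lebesgue_rotate:
  assumes f [measurable]: "f \<in> borel_measurable circle_borel" and \<omega>: "norm \<omega> = 1"
  shows "(\<integral>\<^sup>+ t. f (\<omega> * t) \<partial>circle_lebesgue) = (\<integral>\<^sup>+ t. f t \<partial>circle_lebesgue)"
proof -
  have [measurable]: "(*) \<omega> \<in> circle_borel \<rightarrow>\<^sub>M circle_borel"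
    by (rule measurable_rotate_circle[OF \<omega>])
  define a where "a = Arg2pi \<omega>"
  have a: "0 \<le> a" "a \<le> 2 * pi" "\<omega> = cis a"
    using Arg2pi[of \<omega>] \<omega> by (auto simp: a_def cis_conv_exp is_Arg_def)
  have "(\<integral>\<^sup>+ t. f (\<omega> * t) \<partial>circle_lebesgue)
      = (\<integral>\<^sup>+ x. f (cis (a + x)) * indicator {0..<2 * pi} x \<partial>lborel) / ennreal (2 * pi)"
    by (subst nn_integral_circle_lebesgue) (auto simp: a(3) cis_mult)
  also have "(\<integral>\<^sup>+ x. f (cis (a + x)) * indicator {0..<2 * pi} x \<partial>lborel)
           = (\<integral>\<^sup>+ x. f (cis x) * indicator {0..<2 * pi} x \<partial>lborel)"
    using a by (intro nn_integral_periodic_shift) (auto simp: cis_mult[symmetric])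
  also have "\<dots> / ennreal (2 * pi) = (\<integral>\<^sup>+ t. f t \<partial>circle_lebesgue)"
    by (rule nn_integral_circle_lebesgue[OF f, symmetric])
  finally show ?thesis .
qed


section \<open>Boundary behaviour of Poisson integrals\<close>

lemma borel_measurable_continuous_on_circle:
  fixes f :: "complex \<Rightarrow> 'a :: topological_space"
  assumes "continuous_on unit_circle f"
  shows "f \<in> borel_measurable circle_borel"
  unfolding circle_borel_def by (intro borel_measurable_continuous_on_restrict assms)

lemma bounded_continuous_on_circle:
  fixes f :: "complex \<Rightarrow> real"
  assumes "continuous_on unit_circle f"
  obtains B where "0 \<le> B" "\<And>t. norm t = 1 \<Longrightarrow> \<bar>f t\<bar> \<le> B"
proof -
  have "bounded (f ` unit_circle)"
    by (intro compact_imp_bounded compact_continuous_image assms) auto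
  then obtain B where B: "\<And>x. x \<in> f ` unit_circle \<Longrightarrow> norm x \<le> B"
    unfolding bounded_iff by blast
  show thesis
  proof
    show "0 \<le> max 0 B" by simp
    show "\<bar>f t\<bar> \<le> max 0 B" if "norm t = 1" for t
      using B[of "f t"] that by auto
  qed
qed

lemma integrable_poisson_kernel_mult:
  fixes f :: "complex \<Rightarrow> real"
  assumes f [measurable]: "f \<in> borel_measurable circle_borel"
    and B: "\<And>t. norm t = 1 \<Longrightarrow> \<bar>f t\<bar> \<le> B" and z: "norm z < 1"
  shows "integrable circle_lebesgue (\<lambda>t. f t * Re (herglotz_kernel z t))"
proof (rule circle_lebesgue.integrable_const_bound)
  show "AE t in circle_lebesgue. norm (f t * Re (herglotz_kernel z t)) \<le> B * (2 / (1 - norm z))"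
  proof (rule AE_I2)
    fix t assume "t \<in> space circle_lebesgue"
    hence t: "norm t = 1" by (simp add: circle_lebesgue.space_circle)
    show "norm (f t * Re (herglotz_kernel z t)) \<le> B * (2 / (1 - norm z))"
      unfolding real_norm_def abs_mult
      using B[OF t] abs_Re_le_cmod[of "herglotz_kernel z t"] norm_herglotz_kernel_le[OF t z]
      by (intro mult_mono) auto
  qed
qed measurable

text \<open>The kernel is positive with mean \<open>1\<close>, and at distance at least \<open>\<delta>\<close> from \<open>s\<close> it is
  at most \<open>(1 - r\<^sup>2) / (\<delta> / 2)\<^sup>2\<close> as soon as \<open>1 - r < \<delta> / 2\<close>, so its mass concentrates at \<open>s\<close>.\<close>

lemma poisson_kernel_approximate_identity:
  fixes f :: "complex \<Rightarrow> real"
  assumes cont: "continuous_on unit_circle f" and s: "norm s = 1"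
    and r: "\<And>n. 0 \<le> r n" "\<And>n. r n < 1" "r \<longlonglongrightarrow> 1"
  shows "(\<lambda>n. LINT t|circle_lebesgue. f t * Re (herglotz_kernel (complex_of_real (r n) * s) t)) \<longlonglongrightarrow> f s"
proof (rule LIMSEQ_I)
  fix e :: real assume e: "0 < e"
  obtain B where B: "0 \<le> B" "\<And>t. norm t = 1 \<Longrightarrow> \<bar>f t\<bar> \<le> B"
    using bounded_continuous_on_circle[OF cont] by blast
  note [measurable] = borel_measurable_continuous_on_circle[OF cont]
  obtain \<delta> where \<delta>: "0 < \<delta>" "\<And>t. norm t = 1 \<Longrightarrow> dist t s < \<delta> \<Longrightarrow> \<bar>f t - f s\<bar> < e / 2"
    using cont s e unfolding continuous_on_iff dist_real_def
    by (metis half_gt_zero mem_sphere_0)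
  have lim: "(\<lambda>n. 2 * B * (1 - (r n)\<^sup>2) / (\<delta> / 2)\<^sup>2) \<longlonglongrightarrow> 0" "(\<lambda>n. 1 - r n) \<longlonglongrightarrow> 0"
    using r(3) \<delta> by (auto intro!: tendsto_eq_intros)
  have "\<forall>\<^sub>F n in sequentially. 2 * B * (1 - (r n)\<^sup>2) / (\<delta> / 2)\<^sup>2 < e / 2"
    using lim(1) by (rule order_tendstoD(2)) (use e in simp)
  moreover have "\<forall>\<^sub>F n in sequentially. 1 - r n < \<delta> / 2"
    using lim(2) by (rule order_tendstoD(2)) (use \<delta> in simp)
  ultimately have "\<forall>\<^sub>F n in sequentially.
      norm ((LINT t|circle_lebesgue. f t * Re (herglotz_kernel (complex_of_real (r n) * s) t)) - f s) < e"
  proof eventually_elim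
    case (elim n)
    let ?K = "\<lambda>t. Re (herglotz_kernel (complex_of_real (r n) * s) t)"
    have z: "norm (complex_of_real (r n) * s) < 1"
      using r s by (simp add: norm_mult)
    note int_f = integrable_poisson_kernel_mult[of f B, OF _ B(2) z]
    have int_1: "integrable circle_lebesgue ?K"
      using integrable_poisson_kernel_mult[of "\<lambda>_. 1" 1, OF _ _ z] by simp
    have "(LINT t|circle_lebesgue. f t * ?K t) - f s = (LINT t|circle_lebesgue. f t * ?K t - f s * ?K t)"
      using poisson_kernel_mean[OF s r(1,2)] int_1 int_f by simp
    also have "norm \<dots> \<le> (LINT t|circle_lebesgue. e / 2 * ?K t + 2 * B * (1 - (r n)\<^sup>2) / (\<delta> / 2)\<^sup>2)"
    proof (rule order_trans[OF integral_norm_bound], rule integral_mono)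
      fix t assume "t \<in> space circle_lebesgue"
      hence t: "norm t = 1" by (simp add: circle_lebesgue.space_circle)
      have K: "0 \<le> ?K t" by (rule Re_herglotz_kernel_nonneg[OF t z])
      have r2: "0 \<le> 1 - (r n)\<^sup>2"
        using r by (simp add: power_le_one less_imp_le)
      have "\<bar>f t - f s\<bar> * ?K t \<le> e / 2 * ?K t + 2 * B * (1 - (r n)\<^sup>2) / (\<delta> / 2)\<^sup>2"
      proof (cases "dist t s < \<delta>")
        case True
        have "\<bar>f t - f s\<bar> * ?K t \<le> e / 2 * ?K t"
          using \<delta>(2)[OF t True] K by (intro mult_right_mono) auto
        also have "\<dots> \<le> \<dots> + 2 * B * (1 - (r n)\<^sup>2) / (\<delta> / 2)\<^sup>2"
          using B(1) r2 by simp
        finally show ?thesis .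
      next
        case False
        have "norm (s - complex_of_real (r n) * s) = 1 - r n"
          using r(2)[of n] s
          by (metis abs_of_pos diff_gt_0_iff_gt left_diff_distrib mult.right_neutral mult_1
              norm_mult norm_of_real of_real_1 of_real_diff)
        hence "\<delta> / 2 \<le> norm (t - complex_of_real (r n) * s)"
          using False elim(2) norm_triangle_ineq[of "t - complex_of_real (r n) * s" "complex_of_real (r n) * s - s"]
          by (simp add: dist_norm norm_minus_commute)
        hence "?K t \<le> (1 - (r n)\<^sup>2) / (\<delta> / 2)\<^sup>2"
          unfolding Re_herglotz_kernel[OF t] using r2 \<delta>(1) s r(1)[of n]
          by (intro frac_le power_mono) (auto simp: norm_mult)
        moreover have "\<bar>f t - f s\<bar> \<le> 2 * B"
          using B(2)[OF t] B(2)[OF s] by linarith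
        ultimately have "\<bar>f t - f s\<bar> * ?K t \<le> 2 * B * ((1 - (r n)\<^sup>2) / (\<delta> / 2)\<^sup>2)"
          using K by (intro mult_mono) auto
        thus ?thesis
          using e K by (simp add: add_increasing)
      qed
      thus "norm (f t * ?K t - f s * ?K t) \<le> e / 2 * ?K t + 2 * B * (1 - (r n)\<^sup>2) / (\<delta> / 2)\<^sup>2"
        using K by (simp add: abs_mult flip: left_diff_distrib)
    qed (use int_f int_1 in auto)
    also have "\<dots> = e / 2 + 2 * B * (1 - (r n)\<^sup>2) / (\<delta> / 2)\<^sup>2"
      using int_1 poisson_kernel_mean[OF s r(1,2)] by simp
    also have "\<dots> < e" using elim(1) by simp
    finally show ?case .
  qed
  thus "\<exists>N. \<forall>n\<ge>N. norm ((LINT t|circle_lebesgue. f t * Re (herglotz_kernel (complex_of_real (r n) * s) t)) - f s) < e"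
    by (simp add: eventually_sequentially)
qed

context circle_measure
begin

lemma measurable_poisson_integral [measurable]:
  assumes [measurable]: "g \<in> borel_measurable N"
  shows "(\<lambda>x. poisson_integral \<mu> (g x)) \<in> borel_measurable N"
  unfolding poisson_integral_def by measurable

lemma abs_poisson_integral_le:
  assumes z: "norm z < 1"
  shows "\<bar>poisson_integral \<mu> z\<bar> \<le> 2 / (1 - norm z) * measure \<mu> (space \<mu>)"
proof -
  have "norm (poisson_integral \<mu> z) \<le> (LINT t|\<mu>. 2 / (1 - norm z))"
    unfolding poisson_integral_def
  proof (rule order_trans[OF integral_norm_bound], rule integral_mono)
    fix t assume "t \<in> space \<mu>"
    hence t: "norm t = 1" by (simp add: space_circle)
    show "norm (Re (herglotz_kernel z t)) \<le> 2 / (1 - norm z)"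
      using abs_Re_le_cmod[of "herglotz_kernel z t"] norm_herglotz_kernel_le[OF t z] by simp
  qed (use integrable_herglotz_kernel[OF z] in auto)
  thus ?thesis by (simp add: mult.commute)
qed

lemma integral_mult_poisson_integral:
  fixes f :: "complex \<Rightarrow> real"
  assumes cont: "continuous_on unit_circle f" and r: "0 \<le> r" "r < 1"
  shows "(LINT t|circle_lebesgue. f t * poisson_integral \<mu> (complex_of_real r * t))
       = (LINT s|\<mu>. (LINT t|circle_lebesgue. f t * Re (herglotz_kernel (complex_of_real r * s) t)))"
proof -
  note [measurable] = borel_measurable_continuous_on_circle[OF cont]
  obtain B where B: "0 \<le> B" "\<And>t. norm t = 1 \<Longrightarrow> \<bar>f t\<bar> \<le> B"
    using bounded_continuous_on_circle[OF cont] by blast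
  interpret pair: pair_sigma_finite \<mu> circle_lebesgue ..
  interpret prod: finite_measure "\<mu> \<Otimes>\<^sub>M circle_lebesgue"
    by (intro finite_measure_pair_measure finite_measure_axioms circle_lebesgue.finite_measure_axioms)
  have int: "integrable (\<mu> \<Otimes>\<^sub>M circle_lebesgue)
          (\<lambda>(s, t). f t * Re (herglotz_kernel (complex_of_real r * s) t))"
  proof (rule prod.integrable_const_bound)
    show "AE x in \<mu> \<Otimes>\<^sub>M circle_lebesgue.
        norm (case x of (s, t) \<Rightarrow> f t * Re (herglotz_kernel (complex_of_real r * s) t)) \<le> B * (2 / (1 - r))"
    proof (rule AE_I2)
      fix x assume "x \<in> space (\<mu> \<Otimes>\<^sub>M circle_lebesgue)"
      then obtain s t where x: "x = (s, t)" "norm s = 1" and t: "norm t = 1"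
        by (auto simp: space_pair_measure space_circle circle_lebesgue.space_circle)
      have z: "norm (complex_of_real r * s) = r" using x r by (simp add: norm_mult)
      hence "\<bar>f t\<bar> * \<bar>Re (herglotz_kernel (complex_of_real r * s) t)\<bar> \<le> B * (2 / (1 - r))"
        using B(2)[OF t] abs_Re_le_cmod[of "herglotz_kernel (complex_of_real r * s) t"]
          norm_herglotz_kernel_le[OF t, of "complex_of_real r * s"] r
        by (intro mult_mono) auto
      thus "norm (case x of (s, t) \<Rightarrow> f t * Re (herglotz_kernel (complex_of_real r * s) t)) \<le> B * (2 / (1 - r))"
        by (simp add: x abs_mult)
    qed
  qed measurable
  have "(LINT t|circle_lebesgue. f t * poisson_integral \<mu> (complex_of_real r * t))
      = (LINT t|circle_lebesgue. (LINT s|\<mu>. f t * Re (herglotz_kernel (complex_of_real r * s) t)))"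
  proof (rule Bochner_Integration.integral_cong[OF refl])
    fix t assume "t \<in> space circle_lebesgue"
    hence "norm t = 1" by (simp add: circle_lebesgue.space_circle)
    hence "poisson_integral \<mu> (complex_of_real r * t) = (LINT s|\<mu>. Re (herglotz_kernel (complex_of_real r * s) t))"
      unfolding poisson_integral_def
      by (intro Bochner_Integration.integral_cong refl Re_herglotz_kernel_swap) (simp_all add: space_circle)
    thus "f t * poisson_integral \<mu> (complex_of_real r * t)
        = (LINT s|\<mu>. f t * Re (herglotz_kernel (complex_of_real r * s) t))" by simp
  qed
  also have "\<dots> = (LINT s|\<mu>. (LINT t|circle_lebesgue. f t * Re (herglotz_kernel (complex_of_real r * s) t)))"
    by (rule pair.Fubini_integral[OF int])
  finally show ?thesis .
qed

text \<open>After the order of integration is exchanged, the inner integral is the Poisson integral of the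
  test function; it is bounded by the supremum of the function and converges to it pointwise.\<close>

lemma poisson_integral_weak_limit:
  fixes f :: "complex \<Rightarrow> real"
  assumes cont: "continuous_on unit_circle f"
    and r: "\<And>n. 0 \<le> r n" "\<And>n. r n < 1" "r \<longlonglongrightarrow> 1"
  shows "(\<lambda>n. LINT t|circle_lebesgue. f t * poisson_integral \<mu> (complex_of_real (r n) * t)) \<longlonglongrightarrow> (LINT t|\<mu>. f t)"
  unfolding integral_mult_poisson_integral[OF cont r(1,2)]
proof -
  note [measurable] = borel_measurable_continuous_on_circle[OF cont]
  obtain B where B: "0 \<le> B" "\<And>t. norm t = 1 \<Longrightarrow> \<bar>f t\<bar> \<le> B"
    using bounded_continuous_on_circle[OF cont] by blast
  show "(\<lambda>n. LINT s|\<mu>. (LINT t|circle_lebesgue. f t * Re (herglotz_kernel (complex_of_real (r n) * s) t)))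
      \<longlonglongrightarrow> (LINT t|\<mu>. f t)"
  proof (rule integral_dominated_convergence[where w = "\<lambda>_. B"])
    show "AE s in \<mu>. (\<lambda>n. LINT t|circle_lebesgue. f t * Re (herglotz_kernel (complex_of_real (r n) * s) t)) \<longlonglongrightarrow> f s"
      by (intro AE_I2 poisson_kernel_approximate_identity cont r) (simp add: space_circle)
    show "AE s in \<mu>. norm (LINT t|circle_lebesgue. f t * Re (herglotz_kernel (complex_of_real (r n) * s) t)) \<le> B" for n
    proof (rule AE_I2)
      fix s assume "s \<in> space \<mu>"
      hence s: "norm s = 1" by (simp add: space_circle)
      let ?z = "complex_of_real (r n) * s"
      have z: "norm ?z < 1" using s r by (simp add: norm_mult)
      have int_1: "integrable circle_lebesgue (\<lambda>t. Re (herglotz_kernel ?z t))"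
        using integrable_poisson_kernel_mult[of "\<lambda>_. 1" 1, OF _ _ z] by simp
      have "norm (LINT t|circle_lebesgue. f t * Re (herglotz_kernel ?z t))
          \<le> (LINT t|circle_lebesgue. B * Re (herglotz_kernel ?z t))"
      proof (rule order_trans[OF integral_norm_bound], rule integral_mono)
        fix t assume "t \<in> space circle_lebesgue"
        hence t: "norm t = 1" by (simp add: circle_lebesgue.space_circle)
        show "norm (f t * Re (herglotz_kernel ?z t)) \<le> B * Re (herglotz_kernel ?z t)"
          using B(2)[OF t] Re_herglotz_kernel_nonneg[OF t z]
          by (simp add: abs_mult mult_right_mono)
      qed (use int_1 integrable_poisson_kernel_mult[of f B, OF _ B(2) z] in auto)
      thus "norm (LINT t|circle_lebesgue. f t * Re (herglotz_kernel ?z t)) \<le> B"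
        using poisson_kernel_mean[OF s r(1,2)] by simp
    qed
  qed auto
qed

end


section \<open>Majorants of a singular measure\<close>

text \<open>The parameter \<open>k\<close> is at one's disposal: the smaller the mean of \<open>f\<close>, the larger \<open>k\<close> may be taken,
  and both error terms become small. This excludes that \<open>\<mu>\<close> exceeds \<open>\<nu>\<close> on null sets.\<close>

lemma test_function_bound:
  fixes f :: "complex \<Rightarrow> real"
  assumes \<mu>: "circle_measure \<mu>" and \<nu>: "circle_measure \<nu>" and p: "0 < p"
    and C: "0 \<le> C" "\<And>r. 0 \<le> r \<Longrightarrow> r < 1 \<Longrightarrow>
      (\<integral>\<^sup>+ t. ennreal (exp (p * (poisson_integral \<mu> (complex_of_real r * t)
          - poisson_integral \<nu> (complex_of_real r * t)))) \<partial>circle_lebesgue) \<le> ennreal C"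
    and cont: "continuous_on unit_circle f" and f: "\<And>t. norm t = 1 \<Longrightarrow> 0 \<le> f t \<and> f t \<le> 1"
  shows "(LINT t|\<mu>. f t) \<le> (LINT t|\<nu>. f t) + (k * (LINT t|circle_lebesgue. f t) + exp (- k) * C) / p"
proof -
  interpret \<mu>: circle_measure \<mu> by (rule \<mu>)
  interpret \<nu>: circle_measure \<nu> by (rule \<nu>)
  note [measurable] = borel_measurable_continuous_on_circle[OF cont]
  define r where "r n = 1 - 1 / real (Suc n)" for n
  have r: "0 \<le> r n" "r n < 1" for n
    by (auto simp: r_def field_simps)
  have "r \<longlonglongrightarrow> 1 - 0"
    unfolding r_def using LIMSEQ_inverse_real_of_nat
    by (intro tendsto_diff tendsto_const) (simp add: inverse_eq_divide)
  hence r_lim: "r \<longlonglongrightarrow> 1" by simp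
  have "(LINT t|\<mu>. f t) - (LINT t|\<nu>. f t) \<le> (k * (LINT t|circle_lebesgue. f t) + exp (- k) * C) / p"
  proof (rule LIMSEQ_le_const2)
    show "(\<lambda>n. (LINT t|circle_lebesgue. f t * poisson_integral \<mu> (complex_of_real (r n) * t))
        - (LINT t|circle_lebesgue. f t * poisson_integral \<nu> (complex_of_real (r n) * t)))
        \<longlonglongrightarrow> (LINT t|\<mu>. f t) - (LINT t|\<nu>. f t)"
      by (intro tendsto_diff \<mu>.poisson_integral_weak_limit \<nu>.poisson_integral_weak_limit cont r r_lim)
    show "\<exists>N. \<forall>n\<ge>N. (LINT t|circle_lebesgue. f t * poisson_integral \<mu> (complex_of_real (r n) * t))
        - (LINT t|circle_lebesgue. f t * poisson_integral \<nu> (complex_of_real (r n) * t))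
        \<le> (k * (LINT t|circle_lebesgue. f t) + exp (- k) * C) / p"
    proof (intro exI[of _ 0] allI impI)
      fix n :: nat
      define a where "a t = poisson_integral \<mu> (complex_of_real (r n) * t)" for t
      define b where "b t = poisson_integral \<nu> (complex_of_real (r n) * t)" for t
      define A where "A = 2 / (1 - r n) * measure \<mu> (space \<mu>)"
      define B where "B = 2 / (1 - r n) * measure \<nu> (space \<nu>)"
      have [measurable]: "a \<in> borel_measurable circle_lebesgue" "b \<in> borel_measurable circle_lebesgue"
        unfolding a_def b_def by measurable
      have a: "\<bar>a t\<bar> \<le> A" and b: "\<bar>b t\<bar> \<le> B" if "t \<in> space circle_lebesgue" for t
        using that \<mu>.abs_poisson_integral_le[of "r n * t"] \<nu>.abs_poisson_integral_le[of "r n * t"] r[of n]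
        by (simp_all add: circle_lebesgue.space_circle norm_mult a_def b_def A_def B_def)
      have f': "0 \<le> f t" "f t \<le> 1" "\<bar>f t\<bar> \<le> 1" if "t \<in> space circle_lebesgue" for t
        using f[of t] that by (simp_all add: circle_lebesgue.space_circle)
      have int_f: "integrable circle_lebesgue f"
        by (rule circle_lebesgue.integrable_const_bound[where B = 1]) (use f' in auto)
      have int_fa: "integrable circle_lebesgue (\<lambda>t. f t * a t)"
        by (rule circle_lebesgue.integrable_const_bound[where B = "1 * A"], rule AE_I2)
           (use f' a in \<open>auto simp only: real_norm_def abs_mult intro!: mult_mono\<close>, auto)
      have int_fb: "integrable circle_lebesgue (\<lambda>t. f t * b t)"
        by (rule circle_lebesgue.integrable_const_bound[where B = "1 * B"], rule AE_I2)
           (use f' b in \<open>auto simp only: real_norm_def abs_mult intro!: mult_mono\<close>, auto)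
      have "p * (a t - b t) \<le> p * (A + B)" if "t \<in> space circle_lebesgue" for t
        using a[OF that] b[OF that] p by (intro mult_left_mono) auto
      hence int_exp: "integrable circle_lebesgue (\<lambda>t. exp (p * (a t - b t)))"
        by (intro circle_lebesgue.integrable_const_bound[where B = "exp (p * (A + B))"] AE_I2) auto
      have "ennreal (LINT t|circle_lebesgue. exp (p * (a t - b t))) \<le> ennreal C"
        using C(2)[OF r] int_exp by (subst nn_integral_eq_integral[symmetric]) (auto simp: a_def b_def)
      hence int_exp_le: "(LINT t|circle_lebesgue. exp (p * (a t - b t))) \<le> C"
        using C(1) by simp
      have "(LINT t|circle_lebesgue. f t * a t) - (LINT t|circle_lebesgue. f t * b t)
          = (LINT t|circle_lebesgue. f t * a t - f t * b t)"
        using int_fa int_fb by simp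
      also have "\<dots> \<le> (LINT t|circle_lebesgue. (k * f t + exp (- k) * exp (p * (a t - b t))) / p)"
      proof (rule integral_mono)
        fix t assume t: "t \<in> space circle_lebesgue"
        define x where "x = p * (a t - b t)"
        \<comment> \<open>A weak form of the Young inequality between \<open>x\<close> and \<open>exp x\<close>, with free parameter \<open>k\<close>.\<close>
        have "x \<le> k + exp (x - k)"
          using exp_ge_add_one_self[of "x - k"] by linarith
        hence "f t * x \<le> f t * (k + exp (x - k))"
          using f'[OF t] by (intro mult_left_mono) auto
        also have "\<dots> \<le> k * f t + exp (x - k)"
          using f'[OF t] by (simp add: algebra_simps)
        finally have "f t * x / p \<le> (k * f t + exp (- k) * exp x) / p"
          using p by (intro divide_right_mono) (simp_all add: exp_diff exp_minus field_simps)
        moreover have "f t * x / p = f t * a t - f t * b t"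
          using p by (simp add: x_def field_simps)
        ultimately show "f t * a t - f t * b t \<le> (k * f t + exp (- k) * exp (p * (a t - b t))) / p"
          by (simp add: x_def)
      qed (use int_fa int_fb int_f int_exp in auto)
      also have "\<dots> = (k * (LINT t|circle_lebesgue. f t)
          + exp (- k) * (LINT t|circle_lebesgue. exp (p * (a t - b t)))) / p"
        using int_f int_exp by simp
      also have "\<dots> \<le> (k * (LINT t|circle_lebesgue. f t) + exp (- k) * C) / p"
        using int_exp_le p by (intro divide_right_mono add_left_mono mult_left_mono) auto
      finally show "(LINT t|circle_lebesgue. f t * poisson_integral \<mu> (complex_of_real (r n) * t))
          - (LINT t|circle_lebesgue. f t * poisson_integral \<nu> (complex_of_real (r n) * t))
          \<le> (k * (LINT t|circle_lebesgue. f t) + exp (- k) * C) / p"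
        by (simp add: a_def b_def)
    qed
  qed
  thus ?thesis by simp
qed

lemma (in circle_measure) compact_in_sets:
  assumes "compact K" "K \<subseteq> unit_circle"
  shows "K \<in> sets \<mu>"
  unfolding sets_circle circle_borel_def using assms
  by (subst sets_restrict_space_iff) (auto intro: borel_compact)

text \<open>The truncated distance functions are continuous with values in \<open>[0, 1]\<close>, and they decrease to the
  indicator of \<open>K\<close>.\<close>

lemma (in circle_measure) measure_compact_limit:
  assumes K: "compact K" "K \<noteq> {}" "K \<subseteq> unit_circle"
  shows "(\<lambda>n. LINT t|\<mu>. max 0 (1 - real n * infdist t K)) \<longlonglongrightarrow> measure \<mu> K"
proof -
  have [measurable]: "K \<in> sets \<mu>"
    by (rule compact_in_sets[OF K(1,3)])
  have [measurable]: "(\<lambda>t. infdist t K) \<in> borel_measurable \<mu>"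
    by (intro measurable_compose[OF measurable_ident_circle] borel_measurable_continuous_onI continuous_intros)
  have "(\<lambda>n. LINT t|\<mu>. max 0 (1 - real n * infdist t K)) \<longlonglongrightarrow> (LINT t|\<mu>. indicator K t)"
  proof (rule integral_dominated_convergence[where w = "\<lambda>_. 1"])
    show "AE t in \<mu>. (\<lambda>n. max 0 (1 - real n * infdist t K)) \<longlonglongrightarrow> indicator K t"
    proof (rule AE_I2)
      fix t
      show "(\<lambda>n. max 0 (1 - real n * infdist t K)) \<longlonglongrightarrow> indicator K t"
      proof (cases "t \<in> K")
        case True
        thus ?thesis by simp
      next
        case False
        hence pos: "0 < infdist t K"
          using K infdist_pos_not_in_closed[of K t] compact_imp_closed by auto
        have "\<forall>\<^sub>F n in sequentially. inverse (infdist t K) < real n"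
          using filterlim_real_sequentially by (simp add: filterlim_at_top_dense)
        hence "\<forall>\<^sub>F n in sequentially. max 0 (1 - real n * infdist t K) = indicator K t"
          by eventually_elim (use pos False in \<open>auto simp: field_simps\<close>)
        thus ?thesis by (rule tendsto_eventually)
      qed
    qed
    show "AE t in \<mu>. norm (max 0 (1 - real n * infdist t K)) \<le> 1" for n
      by (auto simp: infdist_nonneg)
  qed auto
  thus ?thesis by simp
qed

lemma compact_null_set_domination:
  assumes \<mu>: "circle_measure \<mu>" and \<nu>: "circle_measure \<nu>" and p: "0 < p"
    and C: "0 \<le> C" "\<And>r. 0 \<le> r \<Longrightarrow> r < 1 \<Longrightarrow>
      (\<integral>\<^sup>+ t. ennreal (exp (p * (poisson_integral \<mu> (complex_of_real r * t)
          - poisson_integral \<nu> (complex_of_real r * t)))) \<partial>circle_lebesgue) \<le> ennreal C"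
    and K: "compact K" "K \<subseteq> unit_circle" and null: "measure circle_lebesgue K = 0"
  shows "measure \<mu> K \<le> measure \<nu> K"
proof (cases "K = {}")
  case False
  interpret \<mu>: circle_measure \<mu> by (rule \<mu>)
  interpret \<nu>: circle_measure \<nu> by (rule \<nu>)
  let ?f = "\<lambda>n t. max 0 (1 - real n * infdist t K)"
  \<comment> \<open>The term with the factor \<open>k\<close> disappears in the limit because \<open>K\<close> is a null set.\<close>
  have k_bound: "measure \<mu> K \<le> measure \<nu> K + exp (- k) * C / p" for k :: real
  proof (rule LIMSEQ_le)
    show "(\<lambda>n. LINT t|\<mu>. ?f n t) \<longlonglongrightarrow> measure \<mu> K"
      by (rule \<mu>.measure_compact_limit[OF K(1) False K(2)])
    have "(\<lambda>n. (LINT t|\<nu>. ?f n t) + (k * (LINT t|circle_lebesgue. ?f n t) + exp (- k) * C) / p)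
        \<longlonglongrightarrow> measure \<nu> K + (k * measure circle_lebesgue K + exp (- k) * C) / p"
      using p by (intro tendsto_intros \<nu>.measure_compact_limit circle_lebesgue.measure_compact_limit K False) auto
    thus "(\<lambda>n. (LINT t|\<nu>. ?f n t) + (k * (LINT t|circle_lebesgue. ?f n t) + exp (- k) * C) / p)
        \<longlonglongrightarrow> measure \<nu> K + exp (- k) * C / p"
      by (simp add: null)
    show "\<exists>N. \<forall>n\<ge>N. (LINT t|\<mu>. ?f n t)
        \<le> (LINT t|\<nu>. ?f n t) + (k * (LINT t|circle_lebesgue. ?f n t) + exp (- k) * C) / p"
      by (intro exI[of _ 0] allI impI test_function_bound[OF \<mu> \<nu> p C])
         (auto intro!: continuous_intros simp: infdist_nonneg)
  qed
  have "(\<lambda>n. measure \<nu> K + exp (- real n) * C / p) \<longlonglongrightarrow> measure \<nu> K + 0 * C / p"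
    using p by (intro tendsto_intros filterlim_compose[OF exp_at_bot]
        filterlim_compose[OF filterlim_uminus_at_bot_at_top] filterlim_real_sequentially) auto
  thus ?thesis
    using k_bound by (intro LIMSEQ_le_const[where X = "\<lambda>n. measure \<nu> K + exp (- real n) * C / p"]) auto
qed auto

text \<open>A singular measure is carried by a null set, so null sets suffice; on these, inner regularity
  reduces the claim to compact sets.\<close>

theorem singular_measure_domination:
  assumes \<mu>: "circle_measure \<mu>" and \<nu>: "circle_measure \<nu>"
    and sing: "mutually_singular \<mu> circle_lebesgue" and p: "0 < p"
    and C: "0 \<le> C" "\<And>r. 0 \<le> r \<Longrightarrow> r < 1 \<Longrightarrow>
      (\<integral>\<^sup>+ t. ennreal (exp (p * (poisson_integral \<mu> (complex_of_real r * t)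
          - poisson_integral \<nu> (complex_of_real r * t)))) \<partial>circle_lebesgue) \<le> ennreal C"
    and E: "E \<in> sets circle_borel"
  shows "emeasure \<mu> E \<le> emeasure \<nu> E"
proof -
  interpret \<mu>: circle_measure \<mu> by (rule \<mu>)
  interpret \<nu>: circle_measure \<nu> by (rule \<nu>)
  have null_case: "emeasure \<mu> F \<le> emeasure \<nu> F"
    if F: "F \<in> sets circle_borel" "emeasure circle_lebesgue F = 0" for F
  proof -
    have F': "F \<in> sets borel" "F \<subseteq> unit_circle"
      using F(1) by (auto simp: circle_borel_def sets_restrict_space_iff)
    have [measurable]: "F \<in> sets borel" by (rule F')
    \<comment> \<open>Inner regularity is a statement about Borel measures on the whole plane, so \<open>\<mu>\<close> is pushed forward there.\<close>
    have distr: "emeasure (distr \<mu> borel (\<lambda>t. t)) G = emeasure \<mu> G"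
      if "G \<in> sets borel" "G \<subseteq> unit_circle" for G
    proof -
      have "(\<lambda>t. t) -` G \<inter> space \<mu> = G" using that by (auto simp: \<mu>.space_circle)
      thus ?thesis using that by (simp add: emeasure_distr)
    qed
    have fin: "emeasure (distr \<mu> borel (\<lambda>t. t)) (space (distr \<mu> borel (\<lambda>t. t))) \<noteq> \<infinity>"
      by (simp add: emeasure_distr)
    have "emeasure (distr \<mu> borel (\<lambda>t. t)) F
        = (SUP K\<in>{K. K \<subseteq> F \<and> compact K}. emeasure (distr \<mu> borel (\<lambda>t. t)) K)"
      using fin F' by (intro inner_regular) auto
    also have "\<dots> \<le> emeasure \<nu> F"
    proof (rule SUP_least)
      fix K assume "K \<in> {K. K \<subseteq> F \<and> compact K}"
      hence K: "K \<subseteq> F" "compact K" by auto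
      have KC: "K \<subseteq> unit_circle" using K F' by blast
      have "emeasure circle_lebesgue K \<le> emeasure circle_lebesgue F"
        using K F by (intro emeasure_mono) (auto simp: circle_lebesgue.sets_circle)
      hence "measure circle_lebesgue K = 0"
        using F(2) by (simp add: measure_def)
      hence "measure \<mu> K \<le> measure \<nu> K"
        by (intro compact_null_set_domination[OF \<mu> \<nu> p C K(2) KC])
      hence "emeasure \<mu> K \<le> emeasure \<nu> K"
        by (simp add: \<mu>.emeasure_eq_measure \<nu>.emeasure_eq_measure)
      also have "\<dots> \<le> emeasure \<nu> F"
        using K F by (intro emeasure_mono) (auto simp: \<nu>.sets_circle)
      finally show "emeasure (distr \<mu> borel (\<lambda>t. t)) K \<le> emeasure \<nu> F"
        by (subst distr[OF borel_compact[OF K(2)] KC])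
    qed
    finally show ?thesis using distr[OF F'] by simp
  qed
  obtain A where A: "A \<in> sets circle_borel" "emeasure \<mu> A = 0"
      "emeasure circle_lebesgue (space circle_lebesgue - A) = 0"
    using sing unfolding mutually_singular_def by (auto simp: \<mu>.sets_circle)
  have EA: "E - A \<in> sets circle_borel" "E \<inter> A \<in> sets circle_borel"
    using E A(1) by auto
  have "emeasure \<mu> E = emeasure \<mu> (E - A)"
    using E A by (intro emeasure_Diff_null_set[symmetric]) (auto simp: null_sets_def \<mu>.sets_circle)
  also have "\<dots> \<le> emeasure \<nu> (E - A)"
  proof (rule null_case[OF EA(1)])
    have "emeasure circle_lebesgue (E - A) \<le> emeasure circle_lebesgue (space circle_lebesgue - A)"
      using E A sets.sets_into_space[of E circle_borel]
        sets_eq_imp_space_eq[OF circle_lebesgue.sets_circle]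
      by (intro emeasure_mono) (auto simp: circle_lebesgue.sets_circle)
    thus "emeasure circle_lebesgue (E - A) = 0" using A(3) by simp
  qed
  also have "\<dots> \<le> emeasure \<nu> E"
    using E by (intro emeasure_mono) (auto simp: \<nu>.sets_circle)
  finally show ?thesis .
qed

lemma (in circle_measure) poisson_integral_mono:
  assumes \<nu>: "circle_measure \<nu>" and le: "\<And>E. E \<in> sets circle_borel \<Longrightarrow> emeasure \<mu> E \<le> emeasure \<nu> E"
    and z: "norm z < 1"
  shows "poisson_integral \<mu> z \<le> poisson_integral \<nu> z"
proof -
  interpret \<nu>: circle_measure \<nu> by (rule \<nu>)
  have "nn_integral \<mu> (\<lambda>t. ennreal (Re (herglotz_kernel z t)))
      \<le> nn_integral \<nu> (\<lambda>t. ennreal (Re (herglotz_kernel z t)))"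
    using le by (intro nn_integral_mono_measure) (auto simp: sets_circle \<nu>.sets_circle le_measure)
  moreover have "nn_integral \<mu> (\<lambda>t. ennreal (Re (herglotz_kernel z t))) = ennreal (poisson_integral \<mu> z)"
    unfolding poisson_integral_def using integrable_herglotz_kernel[OF z] Re_herglotz_kernel_nonneg z
    by (intro nn_integral_eq_integral AE_I2) (auto simp: space_circle)
  moreover have "nn_integral \<nu> (\<lambda>t. ennreal (Re (herglotz_kernel z t))) = ennreal (poisson_integral \<nu> z)"
    unfolding poisson_integral_def using \<nu>.integrable_herglotz_kernel[OF z] Re_herglotz_kernel_nonneg z
    by (intro nn_integral_eq_integral AE_I2) (auto simp: \<nu>.space_circle)
  moreover have "0 \<le> poisson_integral \<nu> z"
    unfolding poisson_integral_def
    by (intro Bochner_Integration.integral_nonneg Re_herglotz_kernel_nonneg z) (simp add: \<nu>.space_circle)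
  ultimately show ?thesis by simp
qed


section \<open>Rotations\<close>

text \<open>The Schwarz lemma for \<open>\<phi>\<close> and for its inverse forces equality in the Schwarz inequality.\<close>

lemma disk_automorphism_fixing_zero:
  assumes aut: "disk_automorphism \<phi>" and zero: "\<phi> 0 = 0"
  obtains \<omega> where "norm \<omega> = 1" "\<And>z. z \<in> unit_disk \<Longrightarrow> \<phi> z = \<omega> * z"
proof -
  define \<psi> where "\<psi> = inv_into unit_disk \<phi>"
  have bij: "bij_betw \<phi> unit_disk unit_disk" and hol: "\<phi> holomorphic_on unit_disk"
    and hol': "\<psi> holomorphic_on unit_disk"
    using aut by (auto simp: disk_automorphism_def \<psi>_def)
  have inv: "\<psi> (\<phi> z) = z" if "z \<in> unit_disk" for z
    using bij that by (simp add: \<psi>_def bij_betw_inv_into_left)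
  have \<phi>_maps: "norm (\<phi> z) < 1" if "norm z < 1" for z
    using bij_betwE[OF bij] that by auto
  have \<psi>_maps: "norm (\<psi> z) < 1" if "norm z < 1" for z
    using bij_betwE[OF bij_betw_inv_into[OF bij]] that by (auto simp: \<psi>_def)
  have \<psi>0: "\<psi> 0 = 0" using inv[of 0] zero by simp
  have half: "norm (1 / 2 :: complex) < 1" by simp
  have "norm (\<psi> (\<phi> (1 / 2))) \<le> norm (\<phi> (1 / 2))"
    by (rule Schwarz_Lemma(1)[OF hol' \<psi>0 \<psi>_maps \<phi>_maps[OF half]])
  moreover have "norm (\<phi> (1 / 2)) \<le> norm (1 / 2 :: complex)"
    by (rule Schwarz_Lemma(1)[OF hol zero \<phi>_maps half])
  ultimately have "norm (\<phi> (1 / 2)) = norm (1 / 2 :: complex)"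
    using inv[of "1 / 2"] by simp
  hence "\<exists>\<omega>. (\<forall>z. norm z < 1 \<longrightarrow> \<phi> z = \<omega> * z) \<and> norm \<omega> = 1"
    by (intro Schwarz_Lemma(3)[OF hol zero \<phi>_maps half] disjI1 exI[of _ "1 / 2"]) auto
  thus thesis using that by auto
qed

lemma circle_extension_rotation:
  assumes \<phi>: "\<And>z. z \<in> unit_disk \<Longrightarrow> \<phi> z = \<omega> * z" and t: "t \<in> unit_circle"
  shows "circle_extension \<phi> t = \<omega> * t"
  unfolding circle_extension_def
proof (rule tendsto_Lim)
  show "at t within unit_disk \<noteq> bot"
    using t by (simp add: trivial_limit_within islimpt_ball)
  have "((\<lambda>z. \<omega> * z) \<longlongrightarrow> \<omega> * t) (at t within unit_disk)"
    by (intro tendsto_intros)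
  thus "(\<phi> \<longlongrightarrow> \<omega> * t) (at t within unit_disk)"
    by (rule Lim_transform_within[OF _ zero_less_one]) (simp add: \<phi>)
qed

text \<open>The preimage of \<open>E\<close> under \<open>t \<mapsto> cnj \<omega> t\<close> is \<open>\<omega> E\<close> when \<open>|\<omega>| = 1\<close>, so this is the measure
  \<open>E \<mapsto> \<mu> (\<omega> E)\<close>.\<close>

definition pullback_rotation :: "complex \<Rightarrow> complex measure \<Rightarrow> complex measure" where
  "pullback_rotation \<omega> \<mu> = distr \<mu> circle_borel ((*) (cnj \<omega>))"

context circle_measure
begin

lemma measurable_rotate:
  assumes "norm \<omega> = 1"
  shows "(*) (cnj \<omega>) \<in> \<mu> \<rightarrow>\<^sub>M circle_borel"
  unfolding measurable_cong_sets[OF sets_circle refl] using assms by (intro measurable_rotate_circle) simp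

lemma circle_measure_pullback_rotation:
  assumes "norm \<omega> = 1"
  shows "circle_measure (pullback_rotation \<omega> \<mu>)"
  unfolding pullback_rotation_def using measurable_rotate[OF assms]
  by (intro circle_measure.intro circle_measure_axioms.intro finite_measure_distr) auto

lemma emeasure_pullback_rotation:
  assumes \<omega>: "norm \<omega> = 1" and E: "E \<in> sets circle_borel"
  shows "emeasure (pullback_rotation \<omega> \<mu>) E = emeasure \<mu> ((*) \<omega> ` E)"
proof -
  have [simp]: "\<omega> * cnj \<omega> = 1" "\<omega> * (cnj \<omega> * x) = x" "cnj \<omega> * (\<omega> * x) = x" for x
    using \<omega> complex_norm_square[of \<omega>] by (simp_all add: mult.commute flip: mult.assoc)
  have "E \<subseteq> unit_circle"
    using E by (auto simp: circle_borel_def sets_restrict_space_iff)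
  hence "(*) (cnj \<omega>) -` E \<inter> space \<mu> = (*) \<omega> ` E"
    using \<omega> by (force simp: space_circle norm_mult image_iff)
  thus ?thesis
    unfolding pullback_rotation_def using measurable_rotate[OF \<omega>] E by (simp add: emeasure_distr)
qed

text \<open>Multiplying the numerator and the denominator of the kernel by \<open>\<omega>\<close> moves the rotation from the
  boundary variable to the interior variable.\<close>

lemma poisson_integral_pullback_rotation:
  assumes \<omega>: "norm \<omega> = 1"
  shows "poisson_integral (pullback_rotation \<omega> \<mu>) z = poisson_integral \<mu> (\<omega> * z)"
proof -
  have [simp]: "\<omega> * cnj \<omega> = 1" "\<omega> * (cnj \<omega> * x) = x" for x
    using \<omega> complex_norm_square[of \<omega>] by (simp_all add: mult.commute flip: mult.assoc)
  have "\<omega> \<noteq> 0" using \<omega> by auto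
  have K: "herglotz_kernel z (cnj \<omega> * t) = herglotz_kernel (\<omega> * z) t" for t
    unfolding herglotz_kernel_def
    using mult_divide_mult_cancel_left[OF \<open>\<omega> \<noteq> 0\<close>, of "cnj \<omega> * t + z" "cnj \<omega> * t - z"]
    by (simp add: distrib_left right_diff_distrib)
  have "(\<lambda>t. Re (herglotz_kernel z t)) \<in> borel_measurable circle_borel"
    using circle_lebesgue.measurable_ident_circle
    unfolding measurable_cong_sets[OF circle_lebesgue.sets_circle refl] by measurable
  thus ?thesis
    unfolding pullback_rotation_def poisson_integral_def
    by (subst integral_distr[OF measurable_rotate[OF \<omega>]]) (auto simp: K)
qed

end


section \<open>Singular inner functions and Hardy spaces\<close>

lemma singular_inner_functionD:
  assumes "singular_inner_function \<mu> S"
  shows "circle_measure \<mu>" "mutually_singular \<mu> circle_lebesgue"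
    and norm_singular_inner_function: "\<And>z. z \<in> unit_disk \<Longrightarrow> norm (S z) = exp (- poisson_integral \<mu> z)"
    and holomorphic_singular_inner_function: "S holomorphic_on unit_disk"
proof -
  show \<mu>: "circle_measure \<mu>" and "mutually_singular \<mu> circle_lebesgue"
    using assms by (auto simp: singular_inner_function_def circle_measure_def circle_measure_axioms_def)
  interpret circle_measure \<mu> by (rule \<mu>)
  obtain \<alpha> where \<alpha>: "norm \<alpha> = 1"
      "\<And>z. z \<in> unit_disk \<Longrightarrow> S z = \<alpha> * exp (- (LINT t|\<mu>. herglotz_kernel z t))"
    using assms by (auto simp: singular_inner_function_def herglotz_kernel_def)
  show "norm (S z) = exp (- poisson_integral \<mu> z)" if "z \<in> unit_disk" for z
    using \<alpha> that by (simp add: norm_mult poisson_integral_eq_Re)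
  have "(\<lambda>z. \<alpha> * exp (- (LINT t|\<mu>. herglotz_kernel z t))) holomorphic_on unit_disk"
    by (intro holomorphic_intros holomorphic_herglotz_integral)
  thus "S holomorphic_on unit_disk"
    by (rule holomorphic_transform) (simp add: \<alpha>)
qed

lemma singular_inner_function_nonzero:
  assumes "singular_inner_function \<mu> S" "z \<in> unit_disk"
  shows "S z \<noteq> 0"
  using norm_singular_inner_function[OF assms] by auto

lemma one_in_hardy_space: "(\<lambda>z\<in>unit_disk. 1) \<in> hardy_space p"
proof -
  have "(\<integral>\<^sup>+ t. ennreal (norm ((\<lambda>z\<in>unit_disk. 1 :: complex) (complex_of_real r * t)) powr p) \<partial>circle_lebesgue) = 1"
    if r: "r \<in> {0..<1}" for r
  proof -
    have "(\<integral>\<^sup>+ t. ennreal (norm ((\<lambda>z\<in>unit_disk. 1 :: complex) (complex_of_real r * t)) powr p) \<partial>circle_lebesgue)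
        = (\<integral>\<^sup>+ t. 1 \<partial>circle_lebesgue)"
      using r by (intro nn_integral_cong) (simp add: circle_lebesgue.space_circle norm_mult)
    thus ?thesis by (simp add: emeasure_space_circle_lebesgue)
  qed
  hence "(SUP r\<in>{0..<1}. \<integral>\<^sup>+ t. ennreal (norm ((\<lambda>z\<in>unit_disk. 1 :: complex) (complex_of_real r * t)) powr p) \<partial>circle_lebesgue) \<le> 1"
    by (intro SUP_least) simp
  moreover have "(\<lambda>z\<in>unit_disk. 1 :: complex) holomorphic_on unit_disk"
    by (rule holomorphic_transform[OF holomorphic_on_const[of 1]]) simp
  ultimately show ?thesis
    unfolding hardy_space_def using order_le_less_trans[OF _ ennreal_one_less_top] by auto
qed

text \<open>Integral means over circles around the origin do not change under rotations.\<close>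

lemma hardy_space_rotate_dominated:
  assumes p: "0 < p" and f: "f \<in> hardy_space p" and \<omega>: "norm \<omega> = 1"
    and h: "h holomorphic_on unit_disk" "h \<in> extensional unit_disk"
    and le: "\<And>z. z \<in> unit_disk \<Longrightarrow> norm (h z) \<le> norm (f (\<omega> * z))"
  shows "h \<in> hardy_space p"
proof -
  have holf: "f holomorphic_on unit_disk"
    using f by (simp add: hardy_space_def)
  have "(\<integral>\<^sup>+ t. ennreal (norm (h (complex_of_real r * t)) powr p) \<partial>circle_lebesgue)
      \<le> (\<integral>\<^sup>+ t. ennreal (norm (f (complex_of_real r * t)) powr p) \<partial>circle_lebesgue)"
    if r: "r \<in> {0..<1}" for r
  proof -
    have "continuous_on unit_circle (\<lambda>t. f (complex_of_real r * t))"
      using r by (intro continuous_on_compose2[OF holomorphic_on_imp_continuous_on[OF holf]] continuous_intros)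
        (auto simp: norm_mult)
    from borel_measurable_continuous_on_circle[OF this]
    have meas: "(\<lambda>t. ennreal (norm (f (complex_of_real r * t)) powr p)) \<in> borel_measurable circle_borel"
      by measurable
    have "(\<integral>\<^sup>+ t. ennreal (norm (h (complex_of_real r * t)) powr p) \<partial>circle_lebesgue)
        \<le> (\<integral>\<^sup>+ t. ennreal (norm (f (complex_of_real r * (\<omega> * t))) powr p) \<partial>circle_lebesgue)"
      using r p le by (intro nn_integral_mono ennreal_leI powr_mono2)
        (auto simp: circle_lebesgue.space_circle norm_mult mult.left_commute)
    also have "\<dots> = (\<integral>\<^sup>+ t. ennreal (norm (f (complex_of_real r * t)) powr p) \<partial>circle_lebesgue)"
      by (rule nn_integral_circle_lebesgue_rotate[OF meas \<omega>])
    finally show ?thesis .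
  qed
  hence "(SUP r\<in>{0..<1}. \<integral>\<^sup>+ t. ennreal (norm (h (complex_of_real r * t)) powr p) \<partial>circle_lebesgue)
      \<le> (SUP r\<in>{0..<1}. \<integral>\<^sup>+ t. ennreal (norm (f (complex_of_real r * t)) powr p) \<partial>circle_lebesgue)"
    by (intro SUP_mono) blast
  also have "\<dots> < \<infinity>" using f by (simp add: hardy_space_def)
  finally show ?thesis using h by (simp add: hardy_space_def)
qed

theorem theorem4p3:
  fixes p :: real
    and \<phi> S\<^sub>1 S\<^sub>2 :: "complex \<Rightarrow> complex"
    and \<mu>\<^sub>1 \<mu>\<^sub>2 :: "complex measure"
  assumes "0 < p"
    and "elliptic_automorphism \<phi>"
    and "\<forall>z\<in>unit_disk. \<phi> z = z \<longleftrightarrow> z = 0"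
    and "singular_inner_function \<mu>\<^sub>1 S\<^sub>1"
    and "singular_inner_function \<mu>\<^sub>2 S\<^sub>2"
  shows "composition_operator \<phi> ` hardy_multiples S\<^sub>1 p \<subseteq> hardy_multiples S\<^sub>2 p \<longleftrightarrow>
    (\<forall>E\<in>sets circle_borel. emeasure \<mu>\<^sub>2 E \<le> emeasure \<mu>\<^sub>1 (circle_extension \<phi> ` E))"
proof -
  have "disk_automorphism \<phi>" "\<phi> 0 = 0"
    using assms(2,3) by (auto simp: elliptic_automorphism_def)
  then obtain \<omega> where \<omega>: "norm \<omega> = 1" and \<phi>: "\<And>z. z \<in> unit_disk \<Longrightarrow> \<phi> z = \<omega> * z"
    using disk_automorphism_fixing_zero by blast
  note \<mu>\<^sub>1 = singular_inner_functionD(1)[OF assms(4)] and \<mu>\<^sub>2 = singular_inner_functionD(1)[OF assms(5)]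
  interpret \<mu>\<^sub>1: circle_measure \<mu>\<^sub>1 by (rule \<mu>\<^sub>1)
  interpret \<mu>\<^sub>2: circle_measure \<mu>\<^sub>2 by (rule \<mu>\<^sub>2)
  define \<nu> where "\<nu> = pullback_rotation \<omega> \<mu>\<^sub>1"
  have \<nu>: "circle_measure \<nu>"
    unfolding \<nu>_def by (rule \<mu>\<^sub>1.circle_measure_pullback_rotation[OF \<omega>])
  have rot: "\<omega> * z \<in> unit_disk" if "z \<in> unit_disk" for z
    using that \<omega> by (simp add: norm_mult)
  have S\<^sub>2_nz: "S\<^sub>2 z \<noteq> 0" if "z \<in> unit_disk" for z
    using singular_inner_function_nonzero[OF assms(5) that] .
  have norm_quotient: "norm (S\<^sub>1 (\<omega> * z) / S\<^sub>2 z) = exp (poisson_integral \<mu>\<^sub>2 z - poisson_integral \<nu> z)"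
    if "z \<in> unit_disk" for z
    using norm_singular_inner_function[OF assms(4) rot[OF that]]
      norm_singular_inner_function[OF assms(5) that] \<mu>\<^sub>1.poisson_integral_pullback_rotation[OF \<omega>, of z]
    by (simp add: norm_divide \<nu>_def exp_diff[symmetric])
  have image: "circle_extension \<phi> ` E = (*) \<omega> ` E" if "E \<in> sets circle_borel" for E
    using that circle_extension_rotation[OF \<phi>]
    by (intro image_cong) (auto simp: circle_borel_def sets_restrict_space_iff)
  have comp: "composition_operator \<phi> (\<lambda>z\<in>unit_disk. S\<^sub>1 z * f z)
      = (\<lambda>z\<in>unit_disk. S\<^sub>1 (\<omega> * z) * f (\<omega> * z))" for f
    using rot by (auto simp: composition_operator_def compose_def \<phi> fun_eq_iff restrict_def)
  have "composition_operator \<phi> ` hardy_multiples S\<^sub>1 p \<subseteq> hardy_multiples S\<^sub>2 p \<longleftrightarrow>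
      (\<forall>E\<in>sets circle_borel. emeasure \<mu>\<^sub>2 E \<le> emeasure \<nu> E)"
  proof
    assume sub: "composition_operator \<phi> ` hardy_multiples S\<^sub>1 p \<subseteq> hardy_multiples S\<^sub>2 p"
    \<comment> \<open>The image of the constant function \<open>1\<close> already carries all the information.\<close>
    have "(\<lambda>z\<in>unit_disk. S\<^sub>1 z * (\<lambda>z\<in>unit_disk. 1) z) \<in> hardy_multiples S\<^sub>1 p"
      unfolding hardy_multiples_def using one_in_hardy_space by (rule imageI)
    hence "(\<lambda>z\<in>unit_disk. S\<^sub>1 (\<omega> * z) * (\<lambda>z\<in>unit_disk. 1) (\<omega> * z)) \<in> hardy_multiples S\<^sub>2 p"
      unfolding comp[symmetric] using sub by blast
    then obtain g where g: "g \<in> hardy_space p"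
        "(\<lambda>z\<in>unit_disk. S\<^sub>1 (\<omega> * z) * (\<lambda>z\<in>unit_disk. 1) (\<omega> * z)) = (\<lambda>z\<in>unit_disk. S\<^sub>2 z * g z)"
      unfolding hardy_multiples_def by blast
    have g_eq: "g z = S\<^sub>1 (\<omega> * z) / S\<^sub>2 z" if "z \<in> unit_disk" for z
      using fun_cong[OF g(2), of z] that rot[OF that] S\<^sub>2_nz[OF that] by (simp add: field_simps)
    define C where "C = (SUP r\<in>{0..<1}. \<integral>\<^sup>+ t. ennreal (norm (g (complex_of_real r * t)) powr p) \<partial>circle_lebesgue)"
    have "C < \<infinity>" using g(1) by (simp add: C_def hardy_space_def)
    show "\<forall>E\<in>sets circle_borel. emeasure \<mu>\<^sub>2 E \<le> emeasure \<nu> E"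
    proof (intro ballI singular_measure_domination[OF \<mu>\<^sub>2 \<nu> singular_inner_functionD(2)[OF assms(5)] assms(1)])
      show "0 \<le> enn2real C" by simp
      fix r :: real assume r: "0 \<le> r" "r < 1"
      have "(\<integral>\<^sup>+ t. ennreal (exp (p * (poisson_integral \<mu>\<^sub>2 (complex_of_real r * t)
            - poisson_integral \<nu> (complex_of_real r * t)))) \<partial>circle_lebesgue)
          = (\<integral>\<^sup>+ t. ennreal (norm (g (complex_of_real r * t)) powr p) \<partial>circle_lebesgue)"
      proof (rule nn_integral_cong)
        fix t assume "t \<in> space circle_lebesgue"
        hence z: "complex_of_real r * t \<in> unit_disk"
          using r by (simp add: circle_lebesgue.space_circle norm_mult)
        show "ennreal (exp (p * (poisson_integral \<mu>\<^sub>2 (complex_of_real r * t)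
            - poisson_integral \<nu> (complex_of_real r * t)))) = ennreal (norm (g (complex_of_real r * t)) powr p)"
          unfolding g_eq[OF z] norm_quotient[OF z] by (simp add: powr_def)
      qed
      also have "\<dots> \<le> C"
        unfolding C_def using r by (intro SUP_upper) auto
      also have "C = ennreal (enn2real C)"
        using \<open>C < \<infinity>\<close> by simp
      finally show "(\<integral>\<^sup>+ t. ennreal (exp (p * (poisson_integral \<mu>\<^sub>2 (complex_of_real r * t)
            - poisson_integral \<nu> (complex_of_real r * t)))) \<partial>circle_lebesgue) \<le> ennreal (enn2real C)" .
    qed
  next
    assume le: "\<forall>E\<in>sets circle_borel. emeasure \<mu>\<^sub>2 E \<le> emeasure \<nu> E"
    show "composition_operator \<phi> ` hardy_multiples S\<^sub>1 p \<subseteq> hardy_multiples S\<^sub>2 p"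
    proof (clarsimp simp: hardy_multiples_def comp)
      fix f assume f: "f \<in> hardy_space p"
      define h where "h = (\<lambda>z\<in>unit_disk. S\<^sub>1 (\<omega> * z) / S\<^sub>2 z * f (\<omega> * z))"
      have "h \<in> hardy_space p"
      proof (rule hardy_space_rotate_dominated[OF assms(1) f \<omega>])
        have "f holomorphic_on unit_disk" using f by (simp add: hardy_space_def)
        note holo = this holomorphic_singular_inner_function[OF assms(4)]
        have rot_image: "(*) \<omega> ` unit_disk \<subseteq> unit_disk"
          using rot by blast
        have "(\<lambda>z. F (\<omega> * z)) holomorphic_on unit_disk" if "F holomorphic_on unit_disk" for F
          using holomorphic_on_compose_gen[OF holomorphic_on_linear that rot_image] unfolding o_def .
        hence "(\<lambda>z. S\<^sub>1 (\<omega> * z) / S\<^sub>2 z * f (\<omega> * z)) holomorphic_on unit_disk"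
          using S\<^sub>2_nz holo holomorphic_singular_inner_function[OF assms(5)]
          by (intro holomorphic_on_mult holomorphic_on_divide) auto
        thus "h holomorphic_on unit_disk"
          by (rule holomorphic_transform) (simp add: h_def)
        show "h \<in> extensional unit_disk" by (simp add: h_def)
        fix z assume z: "z \<in> unit_disk"
        have "poisson_integral \<mu>\<^sub>2 z \<le> poisson_integral \<nu> z"
          using le z by (intro \<mu>\<^sub>2.poisson_integral_mono[OF \<nu>]) auto
        hence "norm (S\<^sub>1 (\<omega> * z) / S\<^sub>2 z) \<le> 1"
          unfolding norm_quotient[OF z] by simp
        hence "norm (S\<^sub>1 (\<omega> * z) / S\<^sub>2 z) * norm (f (\<omega> * z)) \<le> 1 * norm (f (\<omega> * z))"
          by (intro mult_right_mono) auto
        thus "norm (h z) \<le> norm (f (\<omega> * z))"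
          using z by (simp add: h_def norm_mult norm_divide)
      qed
      moreover have "(\<lambda>z\<in>unit_disk. S\<^sub>1 (\<omega> * z) * f (\<omega> * z)) = (\<lambda>z\<in>unit_disk. S\<^sub>2 z * h z)"
        by (intro restrict_ext) (simp add: h_def S\<^sub>2_nz)
      ultimately show "(\<lambda>z\<in>unit_disk. S\<^sub>1 (\<omega> * z) * f (\<omega> * z)) \<in> (\<lambda>f. \<lambda>z\<in>unit_disk. S\<^sub>2 z * f z) ` hardy_space p"
        by blast
    qed
  qed
  also have "\<dots> \<longleftrightarrow> (\<forall>E\<in>sets circle_borel. emeasure \<mu>\<^sub>2 E \<le> emeasure \<mu>\<^sub>1 (circle_extension \<phi> ` E))"
    by (intro ball_cong refl) (simp add: image \<nu>_def \<mu>\<^sub>1.emeasure_pullback_rotation[OF \<omega>])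
  finally show ?thesis .
qed

end
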